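(* Let $\mathcal{P}$ be a subset of $\{A,B,C,D\}$ (a set of letters) and let $\alpha$ be a subset of $\{1,2,3,4,5,6\}$. Put $\mathcal{P}_\alpha=\{X_i: X\in\mathcal{P},\ i\in\alpha\}$, $A_\alpha=\{A_i:i\in\alpha\}$ and $\mathcal{P}_1=\{X_1:X\in\mathcal{P}\}$. Then for every integer $n\ge 1$, $$s_n(\mathcal{P}_\alpha)=s_n(A_\alpha)\cdot s_n(\mathcal{P}_1).$$
   Context: A standard piece is a $2\times 2$ matrix whose four entries are $1,2,3,4$, each occurring exactly once. For $n\ge 1$, a standard $n$-puzzle is a $2\times(n+1)$ matrix whose entries are $1,2,\dots,2n+2$, each occurring exactly once; its pieces are its $n$ submatrices formed by two consecutive columns. The reduction of a piece is the standard piece obtained by replacing its four distinct entries by $1,2,3,4$ in an order-preserving way. A set $\mathcal{P}$ of standard pieces is a support of a puzzle if the reduction of each piece of the puzzle lies in $\mathcal{P}$. $S_n(\mathcal{P})$ is the set of standard $n$-puzzles having $\mathcal{P}$ as a support, and $s_n(\mathcal{P})=|S_n(\mathcal{P})|$. The 24 standard pieces are: $A_1=\left[\begin{smallmatrix}4&3\\1&2\end{smallmatrix}\right]$, $A_2=\left[\begin{smallmatrix}3&4\\1&2\end{smallmatrix}\right]$, $A_3=\left[\begin{smallmatrix}2&4\\1&3\end{smallmatrix}\right]$, $A_4=\left[\begin{smallmatrix}3&4\\2&1\end{smallmatrix}\right]$, $A_5=\left[\begin{smallmatrix}4&3\\2&1\end{smallmatrix}\right]$, $A_6=\left[\begin{smallmatrix}4&2\\3&1\end{smallmatrix}\right]$;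 $B_1=\left[\begin{smallmatrix}4&2\\1&3\end{smallmatrix}\right]$, $B_2=\left[\begin{smallmatrix}3&2\\1&4\end{smallmatrix}\right]$, $B_3=\left[\begin{smallmatrix}2&3\\1&4\end{smallmatrix}\right]$, $B_4=\left[\begin{smallmatrix}3&1\\2&4\end{smallmatrix}\right]$, $B_5=\left[\begin{smallmatrix}4&1\\2&3\end{smallmatrix}\right]$, $B_6=\left[\begin{smallmatrix}4&1\\3&2\end{smallmatrix}\right]$; $C_i$ and $D_i$ are obtained from $B_i$ and $A_i$ respectively by exchanging the top and bottom rows, $1\le i\le 6$. *)

theory Defs
  imports "Jordan_Normal_Form.Gauss_Jordan_Elimination"
begin

text \<open>
  Rows and columns are numbered from 0 as in \<open>Jordan_Normal_Form.Matrix\<close>; row 0 is the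
  top row. Bijectivity says that each admissible number occurs at exactly one position.
\<close>

definition standard_piece :: "nat mat \<Rightarrow> bool" where
  "standard_piece M \<longleftrightarrow> M \<in> carrier_mat 2 2 \<and> bij_betw (\<lambda>ij. M $$ ij) ({0..<2} \<times> {0..<2}) {1..4}"

definition standard_puzzle :: "nat \<Rightarrow> nat mat \<Rightarrow> bool" where
  "standard_puzzle n M \<longleftrightarrow> M \<in> carrier_mat 2 (n + 1) \<and>
     bij_betw (\<lambda>ij. M $$ ij) ({0..<2} \<times> {0..<n + 1}) {1..2 * n + 2}"

definition piece_at :: "nat mat \<Rightarrow> nat \<Rightarrow> nat mat" where
  "piece_at M k = mat 2 2 (\<lambda>(i, j). M $$ (i, k + j))"

definition pieces :: "nat mat \<Rightarrow> nat mat set" where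
  "pieces M = {piece_at M k | k. k + 1 < dim_col M}"

text \<open>
  Each entry is replaced by its rank among the entries of the matrix; on four distinct entries
  this is the order-preserving replacement by 1, 2, 3, 4 (lemmas \<open>standard_piece_reduction\<close>
  and \<open>reduction_less_iff\<close>).
\<close>

definition reduction :: "nat mat \<Rightarrow> nat mat" where
  "reduction M = map_mat (\<lambda>x. card {y \<in> elements_mat M. y \<le> x}) M"

definition support :: "nat mat set \<Rightarrow> nat mat \<Rightarrow> bool" where
  "support P M \<longleftrightarrow> (\<forall>Q \<in> pieces M. reduction Q \<in> P)"

definition S :: "nat \<Rightarrow> nat mat set \<Rightarrow> nat mat set" where
  "S n P = {M. standard_puzzle n M \<and> support P M}"

definition s :: "nat \<Rightarrow> nat mat set \<Rightarrow> nat" where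
  "s n P = card (S n P)"

datatype letter = LA | LB | LC | LD

text \<open>In the tables the pieces are listed by rows; position \<open>i - 1\<close> holds the piece of index
  \<open>i\<close>, and only indices \<open>1, \<dots>, 6\<close> are meaningful.\<close>

definition A_piece :: "nat \<Rightarrow> nat mat" where
  "A_piece i = mat_of_rows_list 2
     ([[[4, 3], [1, 2]],
       [[3, 4], [1, 2]],
       [[2, 4], [1, 3]],
       [[3, 4], [2, 1]],
       [[4, 3], [2, 1]],
       [[4, 2], [3, 1]]] ! (i - 1))"

definition B_piece :: "nat \<Rightarrow> nat mat" where
  "B_piece i = mat_of_rows_list 2
     ([[[4, 2], [1, 3]],
       [[3, 2], [1, 4]],
       [[2, 3], [1, 4]],
       [[3, 1], [2, 4]],
       [[4, 1], [2, 3]],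
       [[4, 1], [3, 2]]] ! (i - 1))"

fun piece :: "letter \<Rightarrow> nat \<Rightarrow> nat mat" where
  "piece LA i = A_piece i"
| "piece LB i = B_piece i"
| "piece LC i = swaprows 0 1 (B_piece i)"
| "piece LD i = swaprows 0 1 (A_piece i)"

lemma rank_less_iff:
  fixes E :: "nat set"
  assumes "finite E" "x \<in> E" "y \<in> E"
  shows "card {z \<in> E. z \<le> x} < card {z \<in> E. z \<le> y} \<longleftrightarrow> x < y"
proof
  assume "x < y"
  then have "y \<notin> {z \<in> E. z \<le> x}" "y \<in> {z \<in> E. z \<le> y}"
    "{z \<in> E. z \<le> x} \<subseteq> {z \<in> E. z \<le> y}" using assms by auto
  then have "{z \<in> E. z \<le> x} \<subset> {z \<in> E. z \<le> y}" by blast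
  then show "card {z \<in> E. z \<le> x} < card {z \<in> E. z \<le> y}"
    using assms by (intro psubset_card_mono) auto
next
  assume less: "card {z \<in> E. z \<le> x} < card {z \<in> E. z \<le> y}"
  show "x < y"
  proof (rule ccontr)
    assume "\<not> x < y"
    then have "card {z \<in> E. z \<le> y} \<le> card {z \<in> E. z \<le> x}"
      using assms by (intro card_mono) auto
    with less show False by simp
  qed
qed

lemma finite_elements_mat: "finite (elements_mat M)"
  by (simp add: elements_mat_def)

lemma reduction_less_iff:
  assumes "M \<in> carrier_mat m n" "i < m" "j < n" "i' < m" "j' < n"
  shows "reduction M $$ (i, j) < reduction M $$ (i', j') \<longleftrightarrow> M $$ (i, j) < M $$ (i', j')"
  using assms rank_less_iff[OF finite_elements_mat, of "M $$ (i, j)" M "M $$ (i', j')"]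
  by (auto simp: reduction_def)

lemma standard_piece_reduction:
  assumes M: "M \<in> carrier_mat 2 2" and inj: "inj_on (\<lambda>ij. M $$ ij) ({0..<2} \<times> {0..<2})"
  shows "standard_piece (reduction M)"
proof -
  let ?I = "{0..<2::nat} \<times> {0..<2::nat}" and ?E = "elements_mat M"
  let ?r = "\<lambda>x. card {y \<in> ?E. y \<le> x}"
  have E: "?E = (\<lambda>ij. M $$ ij) ` ?I"
    using M by (fastforce simp: image_iff dest: elements_matD)
  then have cE: "card ?E = 4" using inj by (simp add: card_image)
  have "inj_on (\<lambda>ij. reduction M $$ ij) ?I"
  proof (rule inj_onI)
    fix p q assume "p \<in> ?I" "q \<in> ?I" and eq: "reduction M $$ p = reduction M $$ q"
    moreover obtain i j i' j' where pq: "p = (i, j)" "q = (i', j')" by fastforce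
    ultimately have "M $$ p = M $$ q"
      using reduction_less_iff[OF M, of i j i' j'] reduction_less_iff[OF M, of i' j' i j] by auto
    then show "p = q" using inj \<open>p \<in> ?I\<close> \<open>q \<in> ?I\<close> by (auto dest: inj_onD)
  qed
  moreover have "(\<lambda>ij. reduction M $$ ij) ` ?I \<subseteq> {1..4}"
  proof
    fix v assume "v \<in> (\<lambda>ij. reduction M $$ ij) ` ?I"
    then obtain x where x: "x \<in> ?E" "v = ?r x" using M by (fastforce simp: reduction_def)
    have "?r x \<le> card ?E" by (intro card_mono) (auto simp: finite_elements_mat)
    moreover have "?r x > 0" using x finite_elements_mat[of M] by (auto simp: card_gt_0_iff)
    ultimately show "v \<in> {1..4}" using x cE by auto
  qed
  ultimately have "bij_betw (\<lambda>ij. reduction M $$ ij) ?I {1..4}"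
    using card_subset_eq[of "{1..4::nat}" "(\<lambda>ij. reduction M $$ ij) ` ?I"]
    by (simp add: bij_betw_def card_image)
  then show ?thesis using M by (simp add: standard_piece_def reduction_def)
qed

lemma standard_piece_piece:
  assumes "i \<in> {1..6}"
  shows "standard_piece (piece X i)"
proof -
  have I: "{0..<2::nat} \<times> {0..<2::nat} = {(0, 0), (0, 1), (1, 0), (1, 1)}"
    and F: "{1..4::nat} = {1, 2, 3, 4}" by auto
  have std: "standard_piece M"
    if "dim_row M = 2" "dim_col M = 2"
      and "M $$ (0, 0) = a" "M $$ (0, 1) = b" "M $$ (1, 0) = c" "M $$ (1, 1) = d"
      and "distinct [a, b, c, d]" and "{a, b, c, d} = {1, 2, 3, 4}" for M a b c d
  proof -
    have "(\<lambda>ij. M $$ ij) ` {(0, 0), (0, 1), (1, 0), (1, 1)} = {a, b, c, d}"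
      by (simp only: image_insert image_empty that(3-6))
    moreover have "inj_on (\<lambda>ij. M $$ ij) {(0, 0), (0, 1), (1, 0), (1, 1)}"
      using that(7) by (simp add: that(3-6)[unfolded One_nat_def])
    moreover have "M \<in> carrier_mat 2 2"
      using that(1,2) by blast
    ultimately show ?thesis
      unfolding standard_piece_def bij_betw_def I F that(8) by blast
  qed
  have "i = 1 \<or> i = 2 \<or> i = 3 \<or> i = 4 \<or> i = 5 \<or> i = 6" using assms by auto
  then show ?thesis
    by (cases X; elim disjE; simp only: piece.simps A_piece_def B_piece_def; intro std[OF _ _ refl refl refl refl])
       (simp_all add: mat_of_rows_list_def insert_commute)
qed

end

theory Submission
  imports Defs
begin

text \<open>
  In \<open>A\<^sub>i\<close> both columns have the larger entry on top, and \<open>B\<^sub>i\<close>, \<open>C\<^sub>i\<close>, \<open>D\<^sub>i\<close> arise from \<open>A\<^sub>i\<close> by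
  exchanging the entries of the second column, of the first column, and of both columns. Since
  such exchanges commute with reduction, a puzzle is the same as a puzzle with the larger entries
  on top together with the set of columns to be turned over. The index condition concerns only
  the former and the letter condition only the latter, so that \<open>s\<^sub>n(P\<^sub>\<alpha>)\<close> is \<open>s\<^sub>n(A\<^sub>\<alpha>)\<close> times a
  number depending on \<open>n\<close> and \<open>P\<close> alone. The case \<open>\<alpha> = {1}\<close> identifies this number as
  \<open>s\<^sub>n(P\<^sub>1)\<close>, because \<open>s\<^sub>n({A\<^sub>1}) = 1\<close>: the columns of such a puzzle are nested intervals.
\<close>

section \<open>Turning columns over\<close>

text \<open>Members of \<open>T\<close> outside the column range have no effect. So a shifted set
  can act on a single piece, as in \<open>piece_at_flip_cols\<close>; in return \<open>T\<close> is
  recovered only up to intersection with \<open>{..<n}\<close>.\<close>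

definition flip_cols :: "nat set \<Rightarrow> 'a mat \<Rightarrow> 'a mat" where
  "flip_cols T M = mat 2 (dim_col M) (\<lambda>(i, j). M $$ (if j \<in> T then 1 - i else i, j))"

definition larger_on_top :: "'a::linorder mat \<Rightarrow> bool" where
  "larger_on_top M \<longleftrightarrow> (\<forall>j < dim_col M. M $$ (1, j) < M $$ (0, j))"

lemma dim_flip_cols [simp]: "dim_row (flip_cols T M) = 2" "dim_col (flip_cols T M) = dim_col M"
  by (simp_all add: flip_cols_def)

lemma flip_cols_carrier [simp]:
  "M \<in> carrier_mat m n \<Longrightarrow> flip_cols T M \<in> carrier_mat 2 n"
  by (simp add: flip_cols_def)

lemma index_flip_cols:
  "M \<in> carrier_mat m n \<Longrightarrow> i < 2 \<Longrightarrow> j < n \<Longrightarrow>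
    flip_cols T M $$ (i, j) = M $$ (if j \<in> T then 1 - i else i, j)"
  by (simp add: flip_cols_def)

lemma flip_cols_flip_cols:
  assumes "M \<in> carrier_mat 2 n"
  shows "flip_cols T (flip_cols T M) = M"
  by (rule eq_matI) (use assms in \<open>auto simp: flip_cols_def\<close>)

lemma flip_cols_cong:
  assumes "M \<in> carrier_mat m n" "T \<inter> {..<n} = U \<inter> {..<n}"
  shows "flip_cols T M = flip_cols U M"
proof -
  have "j \<in> T \<longleftrightarrow> j \<in> U" if "j < n" for j
    using assms(2) that by auto
  then show ?thesis
    using assms(1) by (intro eq_matI) (auto simp: flip_cols_def)
qed

text \<open>Under \<open>larger_on_top\<close>, a column of \<open>flip_cols T M\<close> has its
  larger entry at the bottom exactly when it lies in \<open>T\<close>, so the result determines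
  \<open>T\<close> below \<open>n\<close>; flipping once more recovers the matrix. Used both for
  single pieces and for whole puzzles.\<close>

lemma flip_cols_eq_iff:
  assumes M: "M \<in> carrier_mat 2 n" "larger_on_top M" and N: "N \<in> carrier_mat 2 n" "larger_on_top N"
  shows "flip_cols T M = flip_cols U N \<longleftrightarrow> M = N \<and> T \<inter> {..<n} = U \<inter> {..<n}"
proof
  assume eq: "flip_cols T M = flip_cols U N"
  have "j \<in> T \<longleftrightarrow> j \<in> U" if j: "j < n" for j
  proof -
    have "M $$ (1, j) < M $$ (0, j)" "N $$ (1, j) < N $$ (0, j)"
      using M N j by (auto simp: larger_on_top_def)
    moreover have "flip_cols T M $$ (0, j) = flip_cols U N $$ (0, j)"
      "flip_cols T M $$ (1, j) = flip_cols U N $$ (1, j)"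
      using eq by simp_all
    ultimately show ?thesis
      using j by (auto simp: index_flip_cols[OF M(1)] index_flip_cols[OF N(1)] split: if_splits)
  qed
  then have TU: "T \<inter> {..<n} = U \<inter> {..<n}"
    by auto
  then have "flip_cols T M = flip_cols T N"
    using eq flip_cols_cong[OF N(1)] by metis
  then show "M = N \<and> T \<inter> {..<n} = U \<inter> {..<n}"
    using TU flip_cols_flip_cols[OF M(1)] flip_cols_flip_cols[OF N(1)] by metis
next
  assume "M = N \<and> T \<inter> {..<n} = U \<inter> {..<n}"
  then show "flip_cols T M = flip_cols U N"
    using flip_cols_cong[OF N(1)] by blast
qed

lemma bij_betw_flip_position:
  "bij_betw (\<lambda>(i, j). (if j \<in> T then 1 - i else i, j)) ({0..<2::nat} \<times> {0..<n}) ({0..<2} \<times> {0..<n})"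
  by (rule bij_betw_byWitness[where f' = "\<lambda>(i, j). (if j \<in> T then 1 - i else i, j)"]) auto

lemma bij_betw_index_flip_cols:
  assumes M: "M \<in> carrier_mat 2 n"
    and bij: "bij_betw (\<lambda>ij. M $$ ij) ({0..<2} \<times> {0..<n}) E"
  shows "bij_betw (\<lambda>ij. flip_cols T M $$ ij) ({0..<2} \<times> {0..<n}) E"
proof -
  let ?f = "\<lambda>(i, j). (if j \<in> T then 1 - i else i, j)" and ?I = "{0..<2} \<times> {0..<n}"
  have "flip_cols T M $$ ij = ((\<lambda>ij. M $$ ij) \<circ> ?f) ij" if "ij \<in> ?I" for ij
    using that index_flip_cols[OF M, of "fst ij" "snd ij" T] by (auto split: prod.splits)
  then have "bij_betw (\<lambda>ij. flip_cols T M $$ ij) ?I E \<longleftrightarrow> bij_betw ((\<lambda>ij. M $$ ij) \<circ> ?f) ?I E"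
    by (rule bij_betw_cong)
  with bij_betw_trans[OF bij_betw_flip_position bij] show ?thesis
    by blast
qed

lemma standard_puzzle_flip_cols:
  "standard_puzzle n M \<Longrightarrow> standard_puzzle n (flip_cols T M)"
  unfolding standard_puzzle_def using bij_betw_index_flip_cols flip_cols_carrier by blast

lemma piece_at_carrier [simp]: "piece_at M k \<in> carrier_mat 2 2"
  by (simp add: piece_at_def)

lemma piece_at_flip_cols:
  assumes "M \<in> carrier_mat 2 (n + 1)" "k < n"
  shows "piece_at (flip_cols T M) k = flip_cols {j. k + j \<in> T} (piece_at M k)"
  by (rule eq_matI) (use assms in \<open>auto simp: piece_at_def flip_cols_def\<close>)

lemma elements_mat_eq_image:
  "M \<in> carrier_mat m n \<Longrightarrow> elements_mat M = (\<lambda>ij. M $$ ij) ` ({0..<m} \<times> {0..<n})"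
  by (fastforce simp: image_iff dest: elements_matD)

lemma elements_mat_flip_cols:
  assumes M: "M \<in> carrier_mat 2 n"
  shows "elements_mat (flip_cols T M) = elements_mat M"
proof -
  let ?f = "\<lambda>(i, j). (if j \<in> T then 1 - i else i, j)" and ?I = "{0..<2} \<times> {0..<n}"
  have "(\<lambda>ij. flip_cols T M $$ ij) ` ?I = (\<lambda>ij. M $$ ij) ` ?f ` ?I"
    unfolding image_image by (rule image_cong) (auto simp: index_flip_cols[OF M])
  then show ?thesis
    using bij_betw_imp_surj_on[OF bij_betw_flip_position[of T n]]
    by (simp add: elements_mat_eq_image[OF M] elements_mat_eq_image[OF flip_cols_carrier[OF M]])
qed

lemma reduction_carrier [simp]: "M \<in> carrier_mat m n \<Longrightarrow> reduction M \<in> carrier_mat m n"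
  by (simp add: reduction_def)

text \<open>Ranks are taken within the set of entries, which flipping preserves, so each rank moves
  along with its entry.\<close>

lemma reduction_flip_cols:
  assumes "M \<in> carrier_mat 2 n"
  shows "reduction (flip_cols T M) = flip_cols T (reduction M)"
  by (rule eq_matI)
    (use assms in \<open>auto simp: reduction_def elements_mat_flip_cols[OF assms] index_flip_cols[of _ 2 n]\<close>)

lemma larger_on_top_reduction:
  assumes "M \<in> carrier_mat 2 n"
  shows "larger_on_top (reduction M) \<longleftrightarrow> larger_on_top M"
  using assms reduction_less_iff[OF assms, of 1 _ 0] by (auto simp: larger_on_top_def reduction_def)

lemma larger_on_top_piece_at:
  assumes "larger_on_top M" "M \<in> carrier_mat 2 (n + 1)" "k < n"
  shows "larger_on_top (piece_at M k)"
  using assms by (auto simp: larger_on_top_def piece_at_def)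

text \<open>The columns of \<open>X\<^sub>i\<close> with the larger entry at the bottom.\<close>

fun flipped :: "letter \<Rightarrow> nat set" where
  "flipped LA = {}"
| "flipped LB = {1}"
| "flipped LC = {0}"
| "flipped LD = {0, 1}"

lemma A_piece_carrier [simp]: "i \<in> {1..6} \<Longrightarrow> A_piece i \<in> carrier_mat 2 2"
  using standard_piece_piece[of i LA] by (simp add: standard_piece_def)

lemma less_2_iff: "i < (2::nat) \<longleftrightarrow> i = 0 \<or> i = 1"
  by auto

lemma index_1_6: "i \<in> {1..6} \<longleftrightarrow> i = 1 \<or> i = 2 \<or> i = 3 \<or> i = 4 \<or> i = 5 \<or> i = (6::nat)"
  by auto

lemma larger_on_top_A_piece: "i \<in> {1..6} \<Longrightarrow> larger_on_top (A_piece i)"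
  unfolding index_1_6
  by (elim disjE) (simp_all add: larger_on_top_def A_piece_def mat_of_rows_list_def less_2_iff)

lemma piece_eq_flip_cols:
  assumes i: "i \<in> {1..6}"
  shows "piece X i = flip_cols (flipped X) (A_piece i)"
proof -
  have piece: "piece X i \<in> carrier_mat 2 2"
    using standard_piece_piece[OF i, of X] unfolding standard_piece_def by (rule conjunct1)
  have flip: "flip_cols (flipped X) (A_piece i) \<in> carrier_mat 2 2"
    using A_piece_carrier[OF i] by (rule flip_cols_carrier)
  have "piece X i $$ (j, k) = flip_cols (flipped X) (A_piece i) $$ (j, k)" if "j < 2" "k < 2" for j k
    using i that unfolding index_1_6 less_2_iff
    by - (cases X; elim disjE; hypsubst; simp only: piece.simps flipped.simps A_piece_def B_piece_def;
        simp add: flip_cols_def mat_of_rows_list_def)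
  then show ?thesis
    using carrier_matD[OF piece] carrier_matD[OF flip] by (intro eq_matI) simp_all
qed

section \<open>Separating indices from letters\<close>

lemma S_iff:
  "M \<in> S n P \<longleftrightarrow> standard_puzzle n M \<and> (\<forall>k < n. reduction (piece_at M k) \<in> P)"
  unfolding S_def support_def pieces_def standard_puzzle_def by fastforce

text \<open>The intersection is the trace of \<open>T\<close> on columns \<open>k\<close> and
  \<open>k + 1\<close>, renumbered 0 and 1. Confining \<open>T\<close> to \<open>{..n}\<close>
  counts each choice of columns once.\<close>

definition flip_patterns :: "nat \<Rightarrow> letter set \<Rightarrow> nat set set" where
  "flip_patterns n P = {T. T \<subseteq> {..n} \<and> (\<forall>k < n. \<exists>X \<in> P. {j. k + j \<in> T} \<inter> {..<2} = flipped X)}"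

text \<open>The reduced piece of \<open>N\<close> and every \<open>A_piece i\<close> have their
  larger entries on top, so \<open>flip_cols_eq_iff\<close> splits an equation between flipped
  versions into a condition on \<open>i\<close> alone and one on \<open>X\<close> alone.\<close>

lemma reduction_flip_piece_iff:
  assumes \<alpha>: "\<alpha> \<subseteq> {1..6}" and N: "N \<in> carrier_mat 2 (n + 1)" "larger_on_top N" and k: "k < n"
  shows "reduction (piece_at (flip_cols T N) k) \<in> {piece X i | X i. X \<in> P \<and> i \<in> \<alpha>} \<longleftrightarrow>
    reduction (piece_at N k) \<in> {piece LA i | i. i \<in> \<alpha>} \<and>
    (\<exists>X \<in> P. {j. k + j \<in> T} \<inter> {..<2} = flipped X)"
proof -
  let ?R = "reduction (piece_at N k)" and ?U = "{j. k + j \<in> T}"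
  have R: "?R \<in> carrier_mat 2 2" "larger_on_top ?R"
    using larger_on_top_piece_at[OF N(2,1) k] by (simp_all add: larger_on_top_reduction[of _ 2])
  have "flip_cols ?U ?R = piece X i \<longleftrightarrow> ?R = piece LA i \<and> ?U \<inter> {..<2} = flipped X"
    if "i \<in> \<alpha>" for X i
  proof -
    have i: "i \<in> {1..6}" using that \<alpha> by auto
    have "flipped X \<inter> {..<2} = flipped X" by (cases X) auto
    then show ?thesis
      using flip_cols_eq_iff[OF R A_piece_carrier[OF i] larger_on_top_A_piece[OF i]]
      by (simp add: piece_eq_flip_cols[OF i, of X])
  qed
  then show ?thesis
    by (auto simp: piece_at_flip_cols[OF N(1) k] reduction_flip_cols[of _ 2])
qed

lemma larger_on_top_if_A_support:
  assumes "\<alpha> \<subseteq> {1..6}" "n \<ge> 1" and M: "M \<in> S n {piece LA i | i. i \<in> \<alpha>}"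
  shows "larger_on_top M"
  unfolding larger_on_top_def
proof (intro allI impI)
  fix j assume "j < dim_col M"
  moreover have M2: "M \<in> carrier_mat 2 (n + 1)"
    using M by (simp add: S_iff standard_puzzle_def)
  \<comment> \<open>Column \<open>j < n\<close> is the left column of piece \<open>j\<close>; the
    last column is the right column of piece \<open>n - 1\<close>.\<close>
  ultimately obtain k l where kl: "k < n" "l < 2" "j = k + l"
    using \<open>n \<ge> 1\<close> by (cases "j < n") (auto intro: that[of j 0] that[of "n - 1" 1])
  obtain i where "i \<in> \<alpha>" "reduction (piece_at M k) = A_piece i"
    using M kl by (auto simp: S_iff)
  then have "larger_on_top (piece_at M k)"
    using larger_on_top_A_piece[of i] larger_on_top_reduction[of "piece_at M k" 2] \<open>\<alpha> \<subseteq> {1..6}\<close>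
    by auto
  then show "M $$ (1, j) < M $$ (0, j)"
    using kl by (auto simp: larger_on_top_def piece_at_def)
qed

lemma standard_puzzle_flip_decomposition:
  assumes M: "standard_puzzle n M"
  obtains T N where "T \<subseteq> {..n}" "standard_puzzle n N" "larger_on_top N" "M = flip_cols T N"
proof
  let ?T = "{j. j \<le> n \<and> M $$ (0, j) < M $$ (1, j)}"
  have M2: "M \<in> carrier_mat 2 (n + 1)"
    and inj: "inj_on (\<lambda>ij. M $$ ij) ({0..<2} \<times> {0..<n + 1})"
    using M by (auto simp: standard_puzzle_def bij_betw_def)
  show "?T \<subseteq> {..n}" by auto
  show "standard_puzzle n (flip_cols ?T M)"
    using M by (rule standard_puzzle_flip_cols)
  show "M = flip_cols ?T (flip_cols ?T M)"
    using flip_cols_flip_cols[OF M2] by simp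
  \<comment> \<open>Distinct entries exclude ties, so a column outside \<open>?T\<close> already has
    its strictly larger entry on top.\<close>
  have "M $$ (0, j) \<noteq> M $$ (1, j)" if "j < n + 1" for j
    using inj_onD[OF inj, of "(0, j)" "(1, j)"] that by auto
  then show "larger_on_top (flip_cols ?T M)"
    using M2 by (fastforce simp: larger_on_top_def index_flip_cols[OF M2] not_less order_le_less)
qed

lemma bij_betw_flip_cols_S:
  assumes \<alpha>: "\<alpha> \<subseteq> {1..6}" and n: "n \<ge> 1"
  shows "bij_betw (\<lambda>(N, T). flip_cols T N)
    (S n {piece LA i | i. i \<in> \<alpha>} \<times> flip_patterns n P) (S n {piece X i | X i. X \<in> P \<and> i \<in> \<alpha>})"
    (is "bij_betw ?f (?A \<times> ?F) ?S")
  unfolding bij_betw_def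
proof
  have top: "larger_on_top N" and carr: "N \<in> carrier_mat 2 (n + 1)" if "N \<in> ?A" for N
    using larger_on_top_if_A_support[OF \<alpha> n that] that by (auto simp: S_iff standard_puzzle_def)
  have mem_iff: "flip_cols T N \<in> ?S \<longleftrightarrow> N \<in> ?A \<and> T \<in> ?F"
    if "T \<subseteq> {..n}" "standard_puzzle n N" "larger_on_top N" for T N
  proof -
    have "N \<in> carrier_mat 2 (n + 1)"
      using that(2) by (simp add: standard_puzzle_def)
    note iff = reduction_flip_piece_iff[OF \<alpha> this that(3), of _ T P]
    have "flip_cols T N \<in> ?S \<longleftrightarrow>
        (\<forall>k < n. reduction (piece_at (flip_cols T N) k) \<in> {piece X i | X i. X \<in> P \<and> i \<in> \<alpha>})"
      using standard_puzzle_flip_cols[OF that(2), of T] unfolding S_iff by simp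
    also have "\<dots> \<longleftrightarrow> (\<forall>k < n. reduction (piece_at N k) \<in> {piece LA i | i. i \<in> \<alpha>}) \<and>
        (\<forall>k < n. \<exists>X \<in> P. {j. k + j \<in> T} \<inter> {..<2} = flipped X)"
      using iff by meson
    also have "\<dots> \<longleftrightarrow> N \<in> ?A \<and> T \<in> ?F"
      using that(1,2) unfolding S_iff flip_patterns_def by simp
    finally show ?thesis .
  qed
  show "inj_on ?f (?A \<times> ?F)"
  proof (rule inj_onI, clarify)
    fix N T N' T'
    assume "N \<in> ?A" "T \<in> ?F" "N' \<in> ?A" "T' \<in> ?F" "flip_cols T N = flip_cols T' N'"
    moreover from this have "N = N'" "T \<inter> {..<n + 1} = T' \<inter> {..<n + 1}"
      using flip_cols_eq_iff[OF carr top carr top, of N N' T T'] by simp_all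
    \<comment> \<open>\<open>flip_cols_eq_iff\<close> gives equality only within the column range,
      which contains every pattern in \<open>?F\<close>.\<close>
    moreover have "U \<inter> {..<n + 1} = U" if "U \<in> ?F" for U
      using that by (auto simp: flip_patterns_def)
    ultimately show "N = N' \<and> T = T'" by simp
  qed
  show "?f ` (?A \<times> ?F) = ?S"
  proof (intro equalityI subsetI)
    fix M assume "M \<in> ?f ` (?A \<times> ?F)"
    then obtain N T where "M = flip_cols T N" "N \<in> ?A" "T \<in> ?F" by auto
    moreover from this have "T \<subseteq> {..n}" "standard_puzzle n N"
      by (simp_all add: flip_patterns_def S_iff)
    ultimately show "M \<in> ?S"
      using mem_iff top by blast
  next
    fix M assume M: "M \<in> ?S"
    then have "standard_puzzle n M"
      by (simp add: S_iff)
    then obtain T N where TN: "T \<subseteq> {..n}" "standard_puzzle n N" "larger_on_top N"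
      and M_eq: "M = flip_cols T N"
      by (rule standard_puzzle_flip_decomposition)
    have "N \<in> ?A \<and> T \<in> ?F"
      using M mem_iff[OF TN] unfolding M_eq by (rule iffD1[rotated])
    then show "M \<in> ?f ` (?A \<times> ?F)"
      unfolding M_eq by (intro image_eqI[of _ _ "(N, T)"]) simp_all
  qed
qed

lemma s_eq_mult_card_flip_patterns:
  assumes "\<alpha> \<subseteq> {1..6}" "n \<ge> 1"
  shows "s n {piece X i | X i. X \<in> P \<and> i \<in> \<alpha>} =
    s n {piece LA i | i. i \<in> \<alpha>} * card (flip_patterns n P)"
  using bij_betw_same_card[OF bij_betw_flip_cols_S[OF assms, of P]]
  by (simp add: s_def card_cartesian_product)

section \<open>The unique puzzle supported by the first piece\<close>

lemma strict_chain_diff_le: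
  fixes f :: "nat \<Rightarrow> nat"
  assumes "\<And>i. i < m \<Longrightarrow> f i < f (Suc i)" and "i \<le> j" "j \<le> m"
  shows "f i + (j - i) \<le> f j"
  using assms(2,3)
proof (induction j rule: dec_induct)
  case (step j)
  then show ?case using assms(1)[of j] by simp
qed simp

text \<open>The \<open>m\<close> steps each rise by at least 1, while the bounds on
  \<open>f 0\<close> and \<open>f m\<close> leave room for a total rise of \<open>m\<close> only; so
  nothing can be skipped.\<close>

lemma strict_chain_eq_Suc:
  fixes f :: "nat \<Rightarrow> nat"
  assumes "\<And>i. i < m \<Longrightarrow> f i < f (Suc i)" and "f 0 \<ge> 1" "f m \<le> m + 1" "i \<le> m"
  shows "f i = i + 1"
proof -
  have "f 0 + (i - 0) \<le> f i" "f i + (m - i) \<le> f m"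
    using assms(1,4) by (blast intro: strict_chain_diff_le)+
  then show ?thesis
    using assms(2-4) by linarith
qed

text \<open>Column \<open>j\<close> spans the interval from \<open>j + 1\<close> to
  \<open>2 * n + 2 - j\<close>, strictly inside that of the preceding column.\<close>

definition nested_puzzle :: "nat \<Rightarrow> nat mat" where
  "nested_puzzle n = mat 2 (n + 1) (\<lambda>(i, j). if i = 0 then 2 * n + 2 - j else j + 1)"

lemma standard_puzzle_nested_puzzle: "standard_puzzle n (nested_puzzle n)"
proof -
  have "bij_betw (\<lambda>ij. nested_puzzle n $$ ij) ({0..<2} \<times> {0..<n + 1}) {1..2 * n + 2}"
    by (rule bij_betw_byWitness[where f' = "\<lambda>x. if x \<le> n + 1 then (1, x - 1) else (0, 2 * n + 2 - x)"])
      (auto simp: nested_puzzle_def less_2_iff)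
  then show ?thesis
    by (simp add: standard_puzzle_def nested_puzzle_def)
qed

text \<open>Replaces ranks by inequalities that can be chained from one piece to the next.\<close>

lemma reduction_eq_A_piece_1_iff:
  assumes Q: "Q \<in> carrier_mat 2 2"
  shows "reduction Q = A_piece 1 \<longleftrightarrow>
    Q $$ (1, 0) < Q $$ (1, 1) \<and> Q $$ (1, 1) < Q $$ (0, 1) \<and> Q $$ (0, 1) < Q $$ (0, 0)"
    (is "_ \<longleftrightarrow> ?c < ?d \<and> ?d < ?b \<and> ?b < ?a")
proof
  have entries: "A_piece 1 $$ (0, 0) = 4" "A_piece 1 $$ (0, 1) = 3"
    "A_piece 1 $$ (1, 0) = 1" "A_piece 1 $$ (1, 1) = 2"
    by (simp_all add: A_piece_def mat_of_rows_list_def)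
  {
    assume "reduction Q = A_piece 1"
    then show "?c < ?d \<and> ?d < ?b \<and> ?b < ?a"
      using reduction_less_iff[OF Q, of 1 0 1 1] reduction_less_iff[OF Q, of 1 1 0 1]
        reduction_less_iff[OF Q, of 0 1 0 0] entries by simp
  }
  assume less: "?c < ?d \<and> ?d < ?b \<and> ?b < ?a"
  have E: "elements_mat Q = {?a, ?b, ?c, ?d}"
    unfolding elements_mat_eq_image[OF Q] by (auto simp: image_iff less_2_iff)
  \<comment> \<open>Along the chain these initial segments gain one entry at a time, so the ranks
    are 1, 2, 3, 4.\<close>
  have "{y \<in> elements_mat Q. y \<le> ?c} = {?c}" "{y \<in> elements_mat Q. y \<le> ?d} = {?c, ?d}"
    "{y \<in> elements_mat Q. y \<le> ?b} = {?c, ?d, ?b}"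
    "{y \<in> elements_mat Q. y \<le> ?a} = {?c, ?d, ?b, ?a}"
    unfolding E using less by auto
  then have card: "card {y \<in> elements_mat Q. y \<le> ?c} = 1" "card {y \<in> elements_mat Q. y \<le> ?d} = 2"
    "card {y \<in> elements_mat Q. y \<le> ?b} = 3" "card {y \<in> elements_mat Q. y \<le> ?a} = 4"
    using less by auto
  have A: "A_piece 1 \<in> carrier_mat 2 2" by simp
  show "reduction Q = A_piece 1"
  proof (rule eq_matI)
    fix i j assume "i < dim_row (A_piece 1)" "j < dim_col (A_piece 1)"
    then have ij: "i < 2" "j < 2" using carrier_matD[OF A] by auto
    then have "reduction Q $$ (i, j) = card {y \<in> elements_mat Q. y \<le> Q $$ (i, j)}"
      using Q by (simp add: reduction_def)
    then show "reduction Q $$ (i, j) = A_piece 1 $$ (i, j)"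
      using ij card entries unfolding less_2_iff by (elim disjE) simp_all
  qed (use Q carrier_matD[OF A] in \<open>auto simp: reduction_def\<close>)
qed

lemma S_A_piece_1:
  assumes n: "n \<ge> 1"
  shows "S n {A_piece 1} = {nested_puzzle n}"
proof (intro equalityI subsetI)
  fix M assume M: "M \<in> S n {A_piece 1}"
  then have M2: "M \<in> carrier_mat 2 (n + 1)"
    and bij: "bij_betw (\<lambda>ij. M $$ ij) ({0..<2} \<times> {0..<n + 1}) {1..2 * n + 2}"
    by (simp_all add: S_iff standard_puzzle_def)
  have red: "reduction (piece_at M k) = A_piece 1" if "k < n" for k
    using M that by (simp add: S_iff)
  have less: "M $$ (1, k) < M $$ (1, Suc k)" "M $$ (1, Suc k) < M $$ (0, Suc k)"
    "M $$ (0, Suc k) < M $$ (0, k)" if "k < n" for k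
    using red[OF that] unfolding reduction_eq_A_piece_1_iff[OF piece_at_carrier]
    by (simp_all add: piece_at_def)
  have range: "M $$ (i, j) \<in> {1..2 * n + 2}" if "i < 2" "j < n + 1" for i j
    using bij that by (intro bij_betw_apply[OF bij]) auto
  \<comment> \<open>Reading the bottom row forwards and then the top row backwards gives an increasing sequence.\<close>
  define f where "f i = (if i \<le> n then M $$ (1, i) else M $$ (0, 2 * n + 1 - i))" for i
  have f: "f i = i + 1" if "i \<le> 2 * n + 1" for i
  \<comment> \<open>Here \<open>m = 2 * n + 1\<close>; the end points are \<open>M $$ (1, 0)\<close>
    and \<open>M $$ (0, 0)\<close>, and the latter is at most
    \<open>2 * n + 2 = m + 1\<close>.\<close>
  proof (rule strict_chain_eq_Suc)
    fix i assume i: "i < 2 * n + 1"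
    consider "i < n" | "i = n" | "n < i" by linarith
    then show "f i < f (Suc i)"
    proof cases
      \<comment> \<open>The turn from the bottom row to the top row happens in the last column, the
        right column of piece \<open>n - 1\<close>.\<close>
      case 2
      then show ?thesis using less(2)[of "n - 1"] n by (simp add: f_def)
    next
      case 3
      then show ?thesis
        using less(3)[of "2 * n - i"] i by (simp add: f_def Suc_diff_le)
    qed (use less(1) in \<open>simp add: f_def\<close>)
  qed (use range[of 1 0] range[of 0 0] that in \<open>simp_all add: f_def\<close>)
  have "M = nested_puzzle n"
  proof (rule eq_matI)
    fix i j assume "i < dim_row (nested_puzzle n)" "j < dim_col (nested_puzzle n)"
    then have ij: "i = 0 \<or> i = 1" "j \<le> n"
      by (auto simp: nested_puzzle_def)
    have "M $$ (1, j) = j + 1" "M $$ (0, j) = 2 * n + 2 - j"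
      using f[of j] f[of "2 * n + 1 - j"] ij by (auto simp: f_def split: if_splits)
    then show "M $$ (i, j) = nested_puzzle n $$ (i, j)"
      using ij by (auto simp: nested_puzzle_def)
  qed (use M2 in \<open>simp_all add: nested_puzzle_def\<close>)
  then show "M \<in> {nested_puzzle n}" by simp
next
  fix M assume "M \<in> {nested_puzzle n}"
  moreover have "reduction (piece_at (nested_puzzle n) k) = A_piece 1" if "k < n" for k
    unfolding reduction_eq_A_piece_1_iff[OF piece_at_carrier]
    using that by (auto simp: piece_at_def nested_puzzle_def)
  ultimately show "M \<in> S n {A_piece 1}"
    using standard_puzzle_nested_puzzle by (simp add: S_iff)
qed

theorem theorem5p3:
  fixes P :: "letter set" and \<alpha> :: "nat set" and n :: nat
  assumes "\<alpha> \<subseteq> {1..6}" and "n \<ge> 1"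
  shows "s n {piece X i | X i. X \<in> P \<and> i \<in> \<alpha>} =
         s n {piece LA i | i. i \<in> \<alpha>} * s n {piece X 1 | X. X \<in> P}"
proof -
  have "s n {piece X 1 | X. X \<in> P} = card (flip_patterns n P)"
    using s_eq_mult_card_flip_patterns[of "{1}" n P] S_A_piece_1 \<open>n \<ge> 1\<close> by (simp add: s_def)
  then show ?thesis
    using s_eq_mult_card_flip_patterns[OF assms] by simp
qed

end
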